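(* There exist infinitely many cyclic $(n_3)$ configurations that are unsplittable.
   Context: A combinatorial $(n_3)$ configuration consists of $n$ points and $n$ lines with an incidence relation such that: - each line is incident with 3 points; - each point is incident with 3 lines; - two distinct points lie on at most one common line. Its Levi graph $L$ is the bipartite point–line incidence graph. The configuration is cyclic if it has an automorphism of order $n$ that cyclically permutes the points and cyclically permutes the lines. The square $L^2$ of $L$ joins two distinct vertices iff their distance in $L$ is at most 2. The configuration is splittable if there is a set $\Sigma$ of vertices of $L$ that is independent in $L^2$ and such that $L-\Sigma$ is disconnected. It is unsplittable otherwise. *)

theory Defs
  imports "Graph_Theory.Graph_Theory" "HOL-Combinatorics.Orbits"
begin

record ('p, 'l) incidence_structure =
  points :: "'p set"
  lines :: "'l set"
  incidence :: "('p \<times> 'l) set"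

text \<open>The positivity of \<open>n\<close> only excludes the empty structure.\<close>

definition n3_configuration :: "nat \<Rightarrow> ('p, 'l) incidence_structure \<Rightarrow> bool" where
  "n3_configuration n C \<longleftrightarrow>
     0 < n \<and>
     finite (points C) \<and> card (points C) = n \<and>
     finite (lines C) \<and> card (lines C) = n \<and>
     incidence C \<subseteq> points C \<times> lines C \<and>
     (\<forall>l\<in>lines C. card {p \<in> points C. (p, l) \<in> incidence C} = 3) \<and>
     (\<forall>p\<in>points C. card {l \<in> lines C. (p, l) \<in> incidence C} = 3) \<and>
     (\<forall>p\<in>points C. \<forall>q\<in>points C. p \<noteq> q \<longrightarrow>
        card {l \<in> lines C. (p, l) \<in> incidence C \<and> (q, l) \<in> incidence C} \<le> 1)"

definition isomorphism ::
  "('p, 'l) incidence_structure \<Rightarrow> ('q, 'm) incidence_structure \<Rightarrow> ('p \<Rightarrow> 'q) \<Rightarrow> ('l \<Rightarrow> 'm) \<Rightarrow> bool" where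
  "isomorphism C D f g \<longleftrightarrow>
     bij_betw f (points C) (points D) \<and>
     bij_betw g (lines C) (lines D) \<and>
     (\<forall>p\<in>points C. \<forall>l\<in>lines C. (p, l) \<in> incidence C \<longleftrightarrow> (f p, g l) \<in> incidence D)"

definition isomorphic ::
  "('p, 'l) incidence_structure \<Rightarrow> ('q, 'm) incidence_structure \<Rightarrow> bool" where
  "isomorphic C D \<longleftrightarrow> (\<exists>f g. isomorphism C D f g)"

text \<open>\<^const>\<open>permutes\<close> makes both components the identity off the carriers, so that the
  order of an automorphism can be read off from its powers as functions.\<close>

definition automorphism ::
  "('p, 'l) incidence_structure \<Rightarrow> ('p \<Rightarrow> 'p) \<Rightarrow> ('l \<Rightarrow> 'l) \<Rightarrow> bool" where
  "automorphism C f g \<longleftrightarrow>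
     f permutes points C \<and> g permutes lines C \<and> isomorphism C C f g"

definition has_order :: "('p \<Rightarrow> 'p) \<Rightarrow> ('l \<Rightarrow> 'l) \<Rightarrow> nat \<Rightarrow> bool" where
  "has_order f g n \<longleftrightarrow>
     0 < n \<and> f ^^ n = id \<and> g ^^ n = id \<and>
     (\<forall>k. 0 < k \<and> k < n \<longrightarrow> \<not> (f ^^ k = id \<and> g ^^ k = id))"

definition cyclic_n3_configuration :: "nat \<Rightarrow> ('p, 'l) incidence_structure \<Rightarrow> bool" where
  "cyclic_n3_configuration n C \<longleftrightarrow>
     n3_configuration n C \<and>
     (\<exists>f g. automorphism C f g \<and> has_order f g n \<and>
            cyclic_on f (points C) \<and> cyclic_on g (lines C))"

text \<open>An undirected graph is represented by the digraph having both orientations of each edge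
  as arcs.\<close>

definition levi_graph :: "('p, 'l) incidence_structure \<Rightarrow> ('p + 'l) pair_pre_digraph" where
  "levi_graph C =
     \<lparr> pverts = Inl ` points C \<union> Inr ` lines C,
       parcs = (\<Union>p\<in>points C. \<Union>l\<in>{l \<in> lines C. (p, l) \<in> incidence C}.
                  {(Inl p, Inr l), (Inr l, Inl p)}) \<rparr>"

lemma wf_digraph_levi_graph: "wf_digraph (with_proj (levi_graph C))"
  by unfold_locales (auto simp: levi_graph_def)

text \<open>With unit weights, \<open>\<mu>\<close> is the length of a shortest walk (infinite if there is none).\<close>

definition graph_distance :: "'a pair_pre_digraph \<Rightarrow> 'a \<Rightarrow> 'a \<Rightarrow> ereal" where
  "graph_distance G u v = wf_digraph.\<mu> (with_proj G) (\<lambda>_. 1) u v"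

definition graph_square :: "'a pair_pre_digraph \<Rightarrow> 'a pair_pre_digraph" where
  "graph_square G =
     \<lparr> pverts = pverts G,
       parcs = {(u, v). u \<in> pverts G \<and> v \<in> pverts G \<and> u \<noteq> v \<and> graph_distance G u v \<le> 2} \<rparr>"

definition independent_set :: "'a pair_pre_digraph \<Rightarrow> 'a set \<Rightarrow> bool" where
  "independent_set G S \<longleftrightarrow>
     S \<subseteq> pverts G \<and> (\<forall>u\<in>S. \<forall>v\<in>S. (u, v) \<notin> parcs G)"

definition splittable :: "('p, 'l) incidence_structure \<Rightarrow> bool" where
  "splittable C \<longleftrightarrow>
     (\<exists>S. independent_set (graph_square (levi_graph C)) S \<and>
          \<not> Digraph_Component.connected
               (with_proj (levi_graph C) \<restriction> (pverts (levi_graph C) - S)))"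

abbreviation unsplittable :: "('p, 'l) incidence_structure \<Rightarrow> bool" where
  "unsplittable C \<equiv> \<not> splittable C"

end

theory Submission
  imports Defs
begin

text \<open>
  The family consists of the configurations whose points and lines are the residues modulo \<open>n\<close>,
  point \<open>i\<close> being incident with the lines \<open>i\<close>, \<open>i + 1\<close>, \<open>i + 3\<close>, for \<open>n \<ge> 7\<close>. A set \<open>S\<close> that is
  independent in the square of the Levi graph does not even disconnect it locally: if the point
  \<open>P\<^sub>0\<close> is in \<open>S\<close>, then no point collinear with it is, and its three lines \<open>L\<^sub>0\<close>, \<open>L\<^sub>1\<close>, \<open>L\<^sub>3\<close> are
  joined outside \<open>S\<close> by the paths \<open>L\<^sub>0 P\<^sub>-\<^sub>1 L\<^sub>2 P\<^sub>1 L\<^sub>1\<close> and \<open>L\<^sub>0 P\<^sub>-\<^sub>1 L\<^sub>2 P\<^sub>2 L\<^sub>3\<close> if \<open>L\<^sub>2\<close> is not in \<open>S\<close>.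
  If \<open>L\<^sub>2\<close> is in \<open>S\<close>, then \<open>L\<^sub>-\<^sub>1\<close> and \<open>L\<^sub>4\<close>, which meet it, are not, and the path
  \<open>L\<^sub>0 P\<^sub>-\<^sub>1 L\<^sub>-\<^sub>1 P\<^sub>-\<^sub>2 L\<^sub>1 P\<^sub>1 L\<^sub>4 P\<^sub>3 L\<^sub>3\<close> serves instead. The map \<open>i \<mapsto> -i\<close> exchanges points and lines,
  so the same holds at a deleted line. Hence every walk can be rerouted around \<open>S\<close>.
\<close>

section \<open>Rerouting around deleted vertices, over integer indices\<close>

abbreviation base_line :: "int set" where
  "base_line \<equiv> {0, 1, 3}"

text \<open>\<open>R\<close> stands for reachability after the deletion of \<open>S\<close>. It is
  only a partial equivalence, since a deleted vertex does not reach itself. \<open>P\<close> and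
  \<open>L\<close> need not be injective, so residues modulo \<open>n\<close> fit without any
  wrap-around in the index arithmetic.\<close>

locale packing_deletion =
  fixes P L :: "int \<Rightarrow> 'v" and S :: "'v set" and R :: "'v \<Rightarrow> 'v \<Rightarrow> bool"
  assumes sym: "R x y \<Longrightarrow> R y x"
    and trans: "R x y \<Longrightarrow> R y z \<Longrightarrow> R x z"
    and edge: "s \<in> base_line \<Longrightarrow> P i \<notin> S \<Longrightarrow> L (i + s) \<notin> S \<Longrightarrow> R (P i) (L (i + s))"
    and point_line: "s \<in> base_line \<Longrightarrow> P i \<in> S \<Longrightarrow> L (i + s) \<notin> S"
    and point_point: "s \<in> base_line \<Longrightarrow> t \<in> base_line \<Longrightarrow> s \<noteq> t \<Longrightarrow> P (i - s) \<in> S \<Longrightarrow> P (i - t) \<notin> S"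
    and line_line: "s \<in> base_line \<Longrightarrow> t \<in> base_line \<Longrightarrow> s \<noteq> t \<Longrightarrow> L (i + s) \<in> S \<Longrightarrow> L (i + t) \<notin> S"
begin

text \<open>The point \<open>-(i + s)\<close> lies on the line \<open>-i\<close>, so reflection
  keeps the offsets \<open>s\<close>, while \<open>point_point\<close> and \<open>line_line\<close>
  change places.\<close>

lemma dual: "packing_deletion (\<lambda>i. L (- i)) (\<lambda>i. P (- i)) S R"
proof
  fix i s :: int
  assume s: "s \<in> base_line"
  show "L (- i) \<notin> S \<Longrightarrow> P (- (i + s)) \<notin> S \<Longrightarrow> R (L (- i)) (P (- (i + s)))"
    using edge[OF s, of "- (i + s)"] sym by simp
  show "L (- i) \<in> S \<Longrightarrow> P (- (i + s)) \<notin> S"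
    using point_line[OF s, of "- (i + s)"] by auto
  fix t :: int
  assume t: "t \<in> base_line" "s \<noteq> t"
  show "L (- (i - s)) \<in> S \<Longrightarrow> L (- (i - t)) \<notin> S"
    using line_line[OF s t, of "- i"] by (simp add: add.commute)
  show "P (- (i + s)) \<in> S \<Longrightarrow> P (- (i + t)) \<notin> S"
    using point_point[OF s t, of "- i"] by simp
qed (fact sym, fact trans)

lemma deleted_point:
  assumes "P i \<in> S"
  shows "R (L i) (L (i + 1)) \<and> R (L i) (L (i + 3))"
proof -
  have L: "L i \<notin> S" "L (i + 1) \<notin> S" "L (i + 3) \<notin> S"
    using assms point_line[of 0 i] point_line[of 1 i] point_line[of 3 i] by auto
  \<comment> \<open>The line \<open>L i\<close> rules out \<open>i - 1\<close>, the line
    \<open>L (i + 1)\<close> rules out \<open>i - 2\<close> and \<open>i + 1\<close>, and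
    \<open>L (i + 3)\<close> rules out \<open>i + 2\<close> and \<open>i + 3\<close>.\<close>
  have P: "P (i - 1) \<notin> S" "P (i - 2) \<notin> S" "P (i + 1) \<notin> S" "P (i + 2) \<notin> S" "P (i + 3) \<notin> S"
    using assms point_point[of 0 1 i] point_point[of 1 3 "i + 1"] point_point[of 1 0 "i + 1"]
      point_point[of 3 1 "i + 3"] point_point[of 3 0 "i + 3"] by (auto simp: add.commute)
  have e: "R (P j) (L k)" if "P j \<notin> S" "L k \<notin> S" "k - j \<in> base_line" for j k
    using edge[OF that(3) that(1)] that(2) by simp
  have path: "R (L j) (L k)" if "R (P m) (L j)" "R (P m) (L k)" for j k m
    using that sym trans by blast
  show ?thesis
  proof (cases "L (i + 2) \<in> S")
    case False
    have "R (L i) (L (i + 2))"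
      using P L False by (intro path[of "i - 1"] e) auto
    moreover have "R (L (i + 2)) (L (i + 1))"
      using P L False by (intro path[of "i + 1"] e) auto
    moreover have "R (L (i + 2)) (L (i + 3))"
      using P L False by (intro path[of "i + 2"] e) auto
    ultimately show ?thesis
      using trans by blast
  next
    case True
    \<comment> \<open>\<open>L (i + 2)\<close> meets \<open>L (i - 1)\<close> in
      \<open>P (i - 1)\<close> and \<open>L (i + 4)\<close> in \<open>P (i + 1)\<close>.\<close>
    then have M: "L (i - 1) \<notin> S" "L (i + 4) \<notin> S"
      using line_line[of 3 0 "i - 1"] line_line[of 1 3 "i + 1"] by (auto simp: algebra_simps)
    have "R (L i) (L (i - 1))"
      using P L M by (intro path[of "i - 1"] e) auto
    moreover have "R (L (i - 1)) (L (i + 1))"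
      using P L M by (intro path[of "i - 2"] e) auto
    moreover have "R (L (i + 1)) (L (i + 4))"
      using P L M by (intro path[of "i + 1"] e) auto
    moreover have "R (L (i + 4)) (L (i + 3))"
      using P L M by (intro path[of "i + 3"] e) auto
    ultimately show ?thesis
      using trans by blast
  qed
qed

lemma lines_at_deleted_point:
  assumes "P i \<in> S" "s \<in> base_line" "t \<in> base_line"
  shows "R (L (i + s)) (L (i + t))"
proof -
  \<comment> \<open>Needed for offset \<open>0\<close>. Without reflexivity of \<open>R\<close> it
    comes from going to another line and back.\<close>
  have "R (L i) (L i)"
    using deleted_point[OF assms(1)] sym trans by blast
  then have "R (L i) (L (i + s))" "R (L i) (L (i + t))"
    using deleted_point[OF assms(1)] assms(2,3) by auto
  then show ?thesis
    using sym trans by blast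
qed

lemma points_at_deleted_line:
  assumes "L i \<in> S" "s \<in> base_line" "t \<in> base_line"
  shows "R (P (i - s)) (P (i - t))"
proof -
  interpret dual: packing_deletion "\<lambda>i. L (- i)" "\<lambda>i. P (- i)" S R
    by (rule dual)
  show ?thesis
    using dual.lines_at_deleted_point[of "- i" s t] assms by simp
qed

text \<open>Stated so that it propagates along every edge, those at deleted vertices included.\<close>

definition reaches_point :: "'v \<Rightarrow> int \<Rightarrow> bool" where
  "reaches_point u i \<longleftrightarrow>
     (if P i \<in> S then \<forall>s\<in>base_line. R u (L (i + s)) else R u (P i))"

definition reaches_line :: "'v \<Rightarrow> int \<Rightarrow> bool" where
  "reaches_line u i \<longleftrightarrow>
     (if L i \<in> S then \<forall>s\<in>base_line. R u (P (i - s)) else R u (L i))"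

text \<open>At most one end of an edge is deleted. If one is, all its neighbours are related to each
  other, so reaching the other end is the same as reaching all of them. If none is, the edge itself
  lies in \<open>R\<close>.\<close>

lemma reaches_line_iff:
  assumes s: "s \<in> base_line"
  shows "reaches_line u (i + s) \<longleftrightarrow> reaches_point u i"
proof -
  consider "P i \<in> S" "L (i + s) \<notin> S" | "P i \<notin> S" "L (i + s) \<in> S"
    | "P i \<notin> S" "L (i + s) \<notin> S"
    using point_line[OF s] by blast
  then show ?thesis
  proof cases
    case 1
    have "(\<forall>t\<in>base_line. R u (L (i + t))) \<longleftrightarrow> R u (L (i + s))"
    proof (intro iffI ballI)
      show "R u (L (i + s))" if "\<forall>t\<in>base_line. R u (L (i + t))"
        using that s by (rule bspec)
      show "R u (L (i + t))" if "R u (L (i + s))" "t \<in> base_line" for t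
        using that(1) lines_at_deleted_point[OF 1(1) s that(2)] by (rule trans)
    qed
    with 1 show ?thesis
      by (simp only: reaches_point_def reaches_line_def if_True if_False)
  next
    case 2
    have "(\<forall>t\<in>base_line. R u (P (i + s - t))) \<longleftrightarrow> R u (P i)"
    proof (intro iffI ballI)
      show "R u (P i)" if "\<forall>t\<in>base_line. R u (P (i + s - t))"
        using bspec[OF that s] by simp
      show "R u (P (i + s - t))" if "R u (P i)" "t \<in> base_line" for t
        using trans[OF that(1)] points_at_deleted_line[OF 2(2) s that(2)] by simp
    qed
    with 2 show ?thesis
      by (simp only: reaches_point_def reaches_line_def if_True if_False)
  next
    case 3
    have "R u (P i) \<longleftrightarrow> R u (L (i + s))"
      using trans[of u] edge[OF s 3] sym[OF edge[OF s 3]] by blast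
    then show ?thesis
      using 3 by (simp add: reaches_point_def reaches_line_def)
  qed
qed

text \<open>The points \<open>k\<close> and \<open>k + 1\<close> share the line
  \<open>k + 1\<close>, with offsets \<open>1\<close> and \<open>0\<close>, so the property spreads
  over all integers.\<close>

lemma reaches_point_shift: "reaches_point u i \<longleftrightarrow> reaches_point u j"
proof -
  have step: "reaches_point u k \<longleftrightarrow> reaches_point u (k + 1)" for k
    using reaches_line_iff[of 1 u k] reaches_line_iff[of 0 u "k + 1"] by simp
  have up: "reaches_point u i \<longleftrightarrow> reaches_point u (i + int m)" for i m
  proof (induction m)
    case (Suc m)
    then show ?case
      using step[of "i + int m"] by (simp add: algebra_simps)
  qed simp
  show ?thesis
  proof (cases "i \<le> j")
    case True
    then show ?thesis
      using up[of i "nat (j - i)"] by simp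
  next
    case False
    then show ?thesis
      using up[of j "nat (i - j)"] by simp
  qed
qed

text \<open>At surviving vertices the reachability predicates reduce to \<open>R\<close>. Since
  \<open>x\<close> reaches itself by \<open>R x x\<close>, invariance under shifts carries this to
  \<open>y\<close>.\<close>

lemma all_related:
  assumes x: "x \<notin> S" "x \<in> range P \<union> range L" "R x x"
    and y: "y \<notin> S" "y \<in> range P \<union> range L"
  shows "R x y"
proof -
  have "reaches_point u i \<longleftrightarrow> R u (P i)" if "P i \<notin> S" for u i
    using that by (simp add: reaches_point_def)
  moreover have "reaches_point u i \<longleftrightarrow> R u (L i)" if "L i \<notin> S" for u i
    using that reaches_line_iff[of 0 u i] by (simp add: reaches_line_def)
  ultimately have *: "\<exists>i. reaches_point u i \<longleftrightarrow> R u z" if "z \<notin> S" "z \<in> range P \<union> range L" for u z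
    using that by blast
  show ?thesis
  proof -
    obtain i j where "reaches_point x i \<longleftrightarrow> R x x" "reaches_point x j \<longleftrightarrow> R x y"
      using *[OF x(1,2)] *[OF y] by blast
    then show ?thesis
      using reaches_point_shift[of x i j] x(3) by argo
  qed
qed

end

section \<open>The cyclic configurations with base line \<open>{0, 1, 3}\<close>\<close>

text \<open>The difference is taken in the integers to avoid truncated subtraction. For
  \<open>n = 7\<close> this is the Fano plane, for \<open>n = 8\<close> the Moebius-Kantor
  configuration.\<close>

definition cyclic_structure :: "nat \<Rightarrow> (nat, nat) incidence_structure" where
  "cyclic_structure n =
     \<lparr> points = {..<n}, lines = {..<n},
       incidence = {(p, l). p < n \<and> l < n \<and> (\<exists>s\<in>base_line. int n dvd int l - int p - s)} \<rparr>"

lemma cyclic_structure_simps [simp]: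
  "points (cyclic_structure n) = {..<n}"
  "lines (cyclic_structure n) = {..<n}"
  "(p, l) \<in> incidence (cyclic_structure n) \<longleftrightarrow>
     p < n \<and> l < n \<and> (\<exists>s\<in>base_line. int n dvd int l - int p - s)"
  by (simp_all add: cyclic_structure_def)

text \<open>Names points and lines by arbitrary integers, as \<open>packing_deletion\<close>
  expects.\<close>

definition residue :: "nat \<Rightarrow> int \<Rightarrow> nat" where
  "residue n i = nat (i mod int n)"

lemma residue_less: "0 < n \<Longrightarrow> residue n i < n"
  by (simp add: residue_def nat_less_iff)

lemma int_residue: "0 < n \<Longrightarrow> int (residue n i) = i mod int n"
  by (simp add: residue_def)

lemma residue_of_nat: "p < n \<Longrightarrow> residue n (int p) = p"
  by (simp add: residue_def)

lemma residue_eq_iff: "0 < n \<Longrightarrow> residue n i = residue n j \<longleftrightarrow> int n dvd i - j"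
  by (metis int_residue mod_eq_dvd_iff of_nat_eq_iff)

lemma ex_residue: "p < n \<Longrightarrow> \<exists>i. p = residue n i"
  by (metis residue_of_nat)

lemma incidence_residue_iff:
  assumes "0 < n"
  shows "(residue n i, residue n j) \<in> incidence (cyclic_structure n) \<longleftrightarrow>
    (\<exists>s\<in>base_line. int n dvd j - i - s)"
proof -
  have "(j mod int n - i mod int n - s) mod int n = (j - i - s) mod int n" for s
    by (intro mod_diff_cong) auto
  then have "int n dvd j mod int n - i mod int n - s \<longleftrightarrow> int n dvd j - i - s" for s
    by (simp only: dvd_eq_mod_eq_0)
  then show ?thesis
    using assms by (simp add: residue_less int_residue)
qed

lemma small_dvd_eq:
  assumes "int n dvd i - j" "\<bar>i - j\<bar> < int n"
  shows "i = j"
  using assms zdvd_imp_le[of "int n" "\<bar>i - j\<bar>"] by force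

text \<open>The nonzero differences in \<open>{0, 1, 3}\<close> are \<open>1\<close>,
  \<open>2\<close>, \<open>3\<close> and their negatives, each arising once. Two differences are at
  most 6 apart, so for \<open>n\<close> at least 7 congruent ones are equal; modulo 6,
  \<open>3\<close> and \<open>-3\<close> would coincide.\<close>

lemma base_line_sidon:
  assumes n: "7 \<le> n"
    and mem: "a \<in> base_line" "b \<in> base_line" "c \<in> base_line" "d \<in> base_line"
    and dvd: "int n dvd (a - b) - (c - d)"
  shows "a = b \<or> a = c"
proof -
  have "\<bar>(a - b) - (c - d)\<bar> < int n"
    using n mem by auto
  then have "a - b = c - d"
    using dvd by (rule small_dvd_eq[rotated])
  then show ?thesis
    using mem by auto
qed

lemma residue_base_line_eq_iff:
  assumes "7 \<le> n" "s \<in> base_line" "t \<in> base_line"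
  shows "residue n (i + s) = residue n (i + t) \<longleftrightarrow> s = t"
    and "residue n (i - s) = residue n (i - t) \<longleftrightarrow> s = t"
proof -
  have "\<bar>s - t\<bar> < int n" "\<bar>t - s\<bar> < int n"
    using assms by auto
  then show "residue n (i + s) = residue n (i + t) \<longleftrightarrow> s = t"
    and "residue n (i - s) = residue n (i - t) \<longleftrightarrow> s = t"
    using assms(1) small_dvd_eq[of n s t] small_dvd_eq[of n t s] by (auto simp: residue_eq_iff)
qed

lemma card_residues:
  assumes "7 \<le> n"
  shows "card ((\<lambda>s. residue n (i + s)) ` base_line) = 3"
    and "card ((\<lambda>s. residue n (i - s)) ` base_line) = 3"
proof -
  have "inj_on (\<lambda>s. residue n (i + s)) base_line" "inj_on (\<lambda>s. residue n (i - s)) base_line"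
    using residue_base_line_eq_iff[OF assms] by (meson inj_onI)+
  then show "card ((\<lambda>s. residue n (i + s)) ` base_line) = 3"
    and "card ((\<lambda>s. residue n (i - s)) ` base_line) = 3"
    by (simp_all only: card_image) simp_all
qed

lemma n3_cyclic_structure:
  assumes n: "7 \<le> n"
  shows "n3_configuration n (cyclic_structure n)"
proof -
  have pos: "0 < n"
    using n by simp
  let ?I = "incidence (cyclic_structure n)"
  have line: "{p \<in> {..<n}. (p, residue n j) \<in> ?I} = (\<lambda>s. residue n (j - s)) ` base_line" for j
  proof (intro set_eqI iffI)
    fix p assume p: "p \<in> {p \<in> {..<n}. (p, residue n j) \<in> ?I}"
    then obtain i where i: "p = residue n i"
      using ex_residue by blast
    with p obtain s where "s \<in> base_line" "int n dvd j - i - s"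
      using incidence_residue_iff[OF pos] by blast
    moreover from this have "p = residue n (j - s)"
      using i pos by (simp add: residue_eq_iff dvd_diff_commute algebra_simps)
    ultimately show "p \<in> (\<lambda>s. residue n (j - s)) ` base_line"
      by blast
  next
    fix p assume "p \<in> (\<lambda>s. residue n (j - s)) ` base_line"
    then obtain s where "s \<in> base_line" "p = residue n (j - s)"
      by blast
    moreover from this have "(p, residue n j) \<in> ?I"
      unfolding \<open>p = _\<close> incidence_residue_iff[OF pos] by (intro bexI[of _ s]) simp_all
    ultimately show "p \<in> {p \<in> {..<n}. (p, residue n j) \<in> ?I}"
      using pos by (simp add: residue_less)
  qed
  have point: "{l \<in> {..<n}. (residue n i, l) \<in> ?I} = (\<lambda>s. residue n (i + s)) ` base_line" for i
  proof (intro set_eqI iffI)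
    fix l assume l: "l \<in> {l \<in> {..<n}. (residue n i, l) \<in> ?I}"
    then obtain j where j: "l = residue n j"
      using ex_residue by blast
    with l obtain s where "s \<in> base_line" "int n dvd j - i - s"
      using incidence_residue_iff[OF pos] by blast
    moreover from this have "l = residue n (i + s)"
      using j pos by (simp add: residue_eq_iff algebra_simps)
    ultimately show "l \<in> (\<lambda>s. residue n (i + s)) ` base_line"
      by blast
  next
    fix l assume "l \<in> (\<lambda>s. residue n (i + s)) ` base_line"
    then obtain s where "s \<in> base_line" "l = residue n (i + s)"
      by blast
    moreover from this have "(residue n i, l) \<in> ?I"
      unfolding \<open>l = _\<close> incidence_residue_iff[OF pos] by (intro bexI[of _ s]) simp_all
    ultimately show "l \<in> {l \<in> {..<n}. (residue n i, l) \<in> ?I}"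
      using pos by (simp add: residue_less)
  qed
  have "card {p \<in> {..<n}. (p, l) \<in> ?I} = 3" if "l < n" for l
  proof -
    from ex_residue[OF that] obtain j where "l = residue n j" ..
    then show ?thesis
      using line[of j] card_residues(2)[OF n, of j] by (simp only:)
  qed
  moreover have "card {l \<in> {..<n}. (p, l) \<in> ?I} = 3" if "p < n" for p
  proof -
    from ex_residue[OF that] obtain i where "p = residue n i" ..
    then show ?thesis
      using point[of i] card_residues(1)[OF n, of i] by (simp only:)
  qed
  moreover have "card {l \<in> {..<n}. (p, l) \<in> ?I \<and> (q, l) \<in> ?I} \<le> 1"
    if pq: "p < n" "q < n" "p \<noteq> q" for p q
  proof -
    have "l = m"
      if "(p, l) \<in> ?I" "(q, l) \<in> ?I" "(p, m) \<in> ?I" "(q, m) \<in> ?I" for l m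
    proof -
      from that obtain a b c d where
        mem: "a \<in> base_line" "b \<in> base_line" "c \<in> base_line" "d \<in> base_line" and
        dvd: "int n dvd int l - int p - a" "int n dvd int l - int q - b"
          "int n dvd int m - int p - c" "int n dvd int m - int q - d"
        and lm: "l < n" "m < n"
        unfolding cyclic_structure_simps by blast
      \<comment> \<open>Both \<open>a - b\<close> and \<open>c - d\<close> are congruent to
        \<open>q - p\<close>, whatever the line. Of the two resulting cases, \<open>a = b\<close>
        contradicts \<open>p \<noteq> q\<close> and \<open>a = c\<close> gives
        \<open>l = m\<close>.\<close>
      have "int n dvd (a - b) - (c - d)"
        using dvd_diff[OF dvd_diff[OF dvd(2) dvd(1)] dvd_diff[OF dvd(4) dvd(3)]]
        by (simp add: algebra_simps)
      then have "a = b \<or> a = c"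
        using base_line_sidon[OF n mem] by simp
      then show "l = m"
      proof
        assume "a = b"
        then have "int n dvd int p - int q"
          using dvd_diff[OF dvd(2) dvd(1)] by simp
        then have "int p = int q"
          using pq by (intro small_dvd_eq) auto
        with pq(3) show ?thesis by simp
      next
        assume "a = c"
        then have "int n dvd int l - int m"
          using dvd_diff[OF dvd(1) dvd(3)] by simp
        then have "int l = int m"
          using lm by (intro small_dvd_eq) auto
        then show ?thesis by simp
      qed
    qed
    then show ?thesis
      by (subst card_le_Suc0_iff_eq[unfolded One_nat_def[symmetric]]) auto
  qed
  ultimately show ?thesis
    using pos unfolding n3_configuration_def by (simp del: cyclic_structure_simps(3)) (auto)
qed

section \<open>The rotation as an automorphism of order \<open>n\<close>\<close>

text \<open>Fixing everything from \<open>n\<close> on makes it a permutation of the carrier in the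
  sense of \<open>permutes\<close>, with \<open>n\<close>-th power exactly
  \<open>id\<close>.\<close>

definition rotate_below :: "nat \<Rightarrow> nat \<Rightarrow> nat" where
  "rotate_below n p = (if p < n then (p + 1) mod n else p)"

lemma funpow_rotate_below:
  "(rotate_below n ^^ k) p = (if p < n then (p + k) mod n else p)"
  by (induction k) (auto simp: rotate_below_def mod_Suc_eq)

lemma rotate_below_permutes: "rotate_below n permutes {..<n}"
proof (rule bij_imp_permutes)
  have "rotate_below n ` {..<n} \<subseteq> {..<n}"
    by (auto simp: rotate_below_def)
  moreover have "inj_on (rotate_below n) {..<n}"
    by (auto simp: inj_on_def rotate_below_def mod_Suc split: if_splits)
  ultimately show "bij_betw (rotate_below n) {..<n} {..<n}"
    by (simp add: bij_betw_def endo_inj_surj)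
qed (simp add: rotate_below_def)

lemma cyclic_on_rotate_below:
  assumes "0 < n"
  shows "cyclic_on (rotate_below n) {..<n}"
proof -
  have "p \<in> orbit (rotate_below n) 0" if "p < n" for p
  proof -
    \<comment> \<open>An orbit consists of the positive powers only, so \<open>p + n\<close> steps
      also cover \<open>p = 0\<close>.\<close>
    have "p = (rotate_below n ^^ (p + n)) 0"
      using that by (simp add: funpow_rotate_below)
    then show ?thesis
      using that by (auto simp: orbit_altdef)
  qed
  moreover have "orbit (rotate_below n) 0 \<subseteq> {..<n}"
    using assms by (auto simp: orbit_altdef funpow_rotate_below)
  ultimately have "{..<n} = orbit (rotate_below n) 0"
    by blast
  with assms show ?thesis
    by (intro cyclic_on_singleI[of 0]) auto
qed

lemma rotate_below_residue:
  assumes "0 < n"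
  shows "rotate_below n (residue n i) = residue n (i + 1)"
proof -
  have "int ((residue n i + 1) mod n) = int (residue n (i + 1))"
    using assms by (simp only: int_residue of_nat_mod of_nat_add of_nat_1 mod_add_left_eq)
  then show ?thesis
    using residue_less[OF assms] by (simp only: rotate_below_def of_nat_eq_iff if_True)
qed

lemma cyclic_n3_cyclic_structure:
  assumes n: "7 \<le> n"
  shows "cyclic_n3_configuration n (cyclic_structure n)"
proof -
  let ?f = "rotate_below n"
  have pos: "0 < n"
    using n by simp
  \<comment> \<open>Incidence depends only on the difference of the indices, which the common shift
    by 1 preserves.\<close>
  have "(p, l) \<in> incidence (cyclic_structure n) \<longleftrightarrow> (?f p, ?f l) \<in> incidence (cyclic_structure n)"
    if "p < n" "l < n" for p l
    using ex_residue[OF that(1)] ex_residue[OF that(2)]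
    by (auto simp only: rotate_below_residue[OF pos] incidence_residue_iff[OF pos]) auto
  then have "automorphism (cyclic_structure n) ?f ?f"
    using rotate_below_permutes[of n]
    by (auto simp: automorphism_def isomorphism_def permutes_imp_bij
        simp del: cyclic_structure_simps(3))
  moreover have "?f ^^ n = id"
    by (auto simp: fun_eq_iff funpow_rotate_below)
  moreover have "?f ^^ k \<noteq> id" if "0 < k" "k < n" for k
  proof
    assume "?f ^^ k = id"
    then have "(?f ^^ k) 0 = 0"
      by simp
    then show False
      using that by (simp add: funpow_rotate_below)
  qed
  ultimately show ?thesis
    using n3_cyclic_structure[OF n] cyclic_on_rotate_below[OF pos] pos
    unfolding cyclic_n3_configuration_def has_order_def
    by (intro conjI exI[of _ ?f]) auto
qed

section \<open>Independence in the square of the Levi graph\<close>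

lemma levi_arcs_iff:
  assumes "n3_configuration n C"
  shows "(x, y) \<in> parcs (levi_graph C) \<longleftrightarrow>
    (\<exists>p l. (p, l) \<in> incidence C \<and> ((x, y) = (Inl p, Inr l) \<or> (x, y) = (Inr l, Inl p)))"
  using assms by (auto simp: levi_graph_def n3_configuration_def)

lemma levi_arc_sym: "(x, y) \<in> parcs (levi_graph C) \<Longrightarrow> (y, x) \<in> parcs (levi_graph C)"
  by (auto simp: levi_graph_def)

lemma levi_arc_verts:
  "(x, y) \<in> parcs (levi_graph C) \<Longrightarrow> x \<in> pverts (levi_graph C) \<and> y \<in> pverts (levi_graph C)"
  by (auto simp: levi_graph_def)

text \<open>A walk of one arc bounds the distance by 1. This supplies
  \<open>point_line\<close>.\<close>

lemma independent_square_arc: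
  assumes "independent_set (graph_square (levi_graph C)) S"
    and arc: "(x, y) \<in> parcs (levi_graph C)" and "x \<in> S"
  shows "y \<notin> S"
proof -
  interpret wf_digraph "with_proj (levi_graph C)"
    by (rule wf_digraph_levi_graph)
  have "awalk x [(x, y)] y"
    using arc levi_arc_verts[OF arc] by (simp add: awalk_def)
  then have "\<mu> (\<lambda>_. 1) x y \<le> ereal (awalk_cost (\<lambda>_. 1) [(x, y)])"
    by (rule min_cost_le_walk_cost)
  also have "\<dots> \<le> 2"
    by simp
  finally have "graph_distance (levi_graph C) x y \<le> 2"
    by (simp add: graph_distance_def)
  moreover have "x \<noteq> y"
    using arc by (auto simp: levi_graph_def)
  ultimately show ?thesis
    using assms levi_arc_verts[OF arc] by (auto simp: independent_set_def graph_square_def)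
qed

text \<open>A walk of two arcs bounds the distance by 2. With \<open>z\<close> a line this supplies
  \<open>point_point\<close>, with \<open>z\<close> a point \<open>line_line\<close>.\<close>

lemma independent_square_common_neighbour:
  assumes "independent_set (graph_square (levi_graph C)) S"
    and arc: "(x, z) \<in> parcs (levi_graph C)" "(z, y) \<in> parcs (levi_graph C)"
    and "x \<noteq> y" "x \<in> S"
  shows "y \<notin> S"
proof -
  interpret wf_digraph "with_proj (levi_graph C)"
    by (rule wf_digraph_levi_graph)
  have "awalk x [(x, z), (z, y)] y"
    using arc levi_arc_verts[OF arc(1)] by (simp add: awalk_def)
  then have "\<mu> (\<lambda>_. 1) x y \<le> ereal (awalk_cost (\<lambda>_. 1) [(x, z), (z, y)])"
    by (rule min_cost_le_walk_cost)
  also have "\<dots> \<le> 2"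
    by simp
  finally have "graph_distance (levi_graph C) x y \<le> 2"
    by (simp add: graph_distance_def)
  then show ?thesis
    using assms levi_arc_verts[OF arc(1)] levi_arc_verts[OF arc(2)]
    by (auto simp: independent_set_def graph_square_def)
qed

section \<open>Unsplittability\<close>

lemma unsplittable_cyclic_structure:
  assumes n: "7 \<le> n"
  shows "unsplittable (cyclic_structure n)"
proof -
  let ?G = "levi_graph (cyclic_structure n)"
  have pos: "0 < n"
    using n by simp
  define P :: "int \<Rightarrow> nat + nat" where "P i = Inl (residue n i)" for i
  define L :: "int \<Rightarrow> nat + nat" where "L i = Inr (residue n i)" for i
  have arc: "(P i, L (i + s)) \<in> parcs ?G" if "s \<in> base_line" for i s
  proof -
    have "(residue n i, residue n (i + s)) \<in> incidence (cyclic_structure n)"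
      unfolding incidence_residue_iff[OF pos] using that by (intro bexI[of _ s]) simp_all
    then show ?thesis
      unfolding levi_arcs_iff[OF n3_cyclic_structure[OF n]] P_def L_def by blast
  qed
  have arc': "(P (i - s), L i) \<in> parcs ?G" if "s \<in> base_line" for i s
    using arc[OF that, of "i - s"] by simp
  have distinct: "P (i - s) \<noteq> P (i - t)" "L (i + s) \<noteq> L (i + t)"
    if "s \<in> base_line" "t \<in> base_line" "s \<noteq> t" for i s t
    using residue_base_line_eq_iff[OF n that(1,2)] that(3) by (simp_all only: P_def L_def) simp_all
  have verts: "pverts ?G \<subseteq> range P \<union> range L"
    using ex_residue by (auto simp: levi_graph_def P_def L_def image_iff)
  have "Digraph_Component.connected (with_proj ?G \<restriction> (pverts ?G - S))"
    if indep: "independent_set (graph_square ?G) S" for S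
  proof -
    \<comment> \<open>Connectedness of a digraph means strong connectedness of its symmetric
      closure, hence \<open>mk_symmetric\<close>. The Levi graph is already symmetric, so by
      \<open>arcs_H\<close> no arcs are added.\<close>
    let ?H = "with_proj (mk_symmetric (with_proj ?G \<restriction> (pverts ?G - S)))"
    have arcs_H: "arcs_ends ?H = {(x, y) \<in> parcs ?G. x \<notin> S \<and> y \<notin> S}"
      using levi_arc_sym levi_arc_verts by (fastforce simp: mk_symmetric_def arcs_ends_conv)
    have verts_H: "verts ?H = pverts ?G - S"
      by (simp add: mk_symmetric_def)
    interpret H: wf_digraph ?H
      using levi_arc_verts levi_arc_sym by unfold_locales (auto simp: mk_symmetric_def)
    have H_sym: "symmetric ?H"
      unfolding symmetric_def arcs_H sym_def using levi_arc_sym by fastforce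
    interpret packing_deletion P L S "\<lambda>x y. x \<rightarrow>\<^sup>*\<^bsub>?H\<^esub> y"
    proof
      show "x \<rightarrow>\<^sup>*\<^bsub>?H\<^esub> y \<Longrightarrow> y \<rightarrow>\<^sup>*\<^bsub>?H\<^esub> x" for x y
        using H_sym by (rule symmetric_reachable)
      show "x \<rightarrow>\<^sup>*\<^bsub>?H\<^esub> y \<Longrightarrow> y \<rightarrow>\<^sup>*\<^bsub>?H\<^esub> z \<Longrightarrow> x \<rightarrow>\<^sup>*\<^bsub>?H\<^esub> z" for x y z
        by (rule H.reachable_trans)
      fix i s :: int
      assume s: "s \<in> base_line"
      show "P i \<notin> S \<Longrightarrow> L (i + s) \<notin> S \<Longrightarrow> P i \<rightarrow>\<^sup>*\<^bsub>?H\<^esub> L (i + s)"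
        using arc[OF s] by (intro H.reachable_adjI) (simp only: arcs_H, simp)
      show "P i \<in> S \<Longrightarrow> L (i + s) \<notin> S"
        using independent_square_arc[OF indep arc[OF s]] .
      fix t :: int
      assume t: "t \<in> base_line" and st: "s \<noteq> t"
      show "P (i - s) \<in> S \<Longrightarrow> P (i - t) \<notin> S"
        using independent_square_common_neighbour[OF indep arc'[OF s] levi_arc_sym[OF arc'[OF t]]]
          distinct(1)[OF s t st] by blast
      show "L (i + s) \<in> S \<Longrightarrow> L (i + t) \<notin> S"
        using independent_square_common_neighbour[OF indep levi_arc_sym[OF arc[OF s]] arc[OF t]]
          distinct(2)[OF s t st] by blast
    qed
    \<comment> \<open>Strong connectedness includes having a vertex; the incident pair
      \<open>P 0\<close>, \<open>L 0\<close> cannot both be deleted.\<close>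
    have "P 0 \<notin> S \<or> L 0 \<notin> S"
      using point_line[of 0 0] by auto
    moreover have "P 0 \<in> pverts ?G" "L 0 \<in> pverts ?G"
      using levi_arc_verts[OF arc[of 0 0]] by auto
    ultimately have "verts ?H \<noteq> {}"
      unfolding verts_H by blast
    moreover have "x \<rightarrow>\<^sup>*\<^bsub>?H\<^esub> y" if "x \<in> verts ?H" "y \<in> verts ?H" for x y
    proof -
      have *: "x \<notin> S" "x \<in> range P \<union> range L" "y \<notin> S" "y \<in> range P \<union> range L"
        using that verts unfolding verts_H by blast+
      show ?thesis
        by (rule all_related[OF *(1,2) H.reachable_refl[OF that(1)] *(3,4)])
    qed
    ultimately show ?thesis
      unfolding Digraph_Component.connected_def by (intro strongly_connectedI) auto
  qed
  then show ?thesis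
    unfolding splittable_def by blast
qed

section \<open>Infinitely many isomorphism classes\<close>

lemma isomorphic_card_points: "isomorphic C D \<Longrightarrow> card (points C) = card (points D)"
  by (auto simp: isomorphic_def isomorphism_def dest: bij_betw_same_card)

theorem theorem9:
  shows "\<exists>\<C> :: (nat, nat) incidence_structure set.
           infinite \<C> \<and>
           pairwise (\<lambda>C D. \<not> isomorphic C D) \<C> \<and>
           (\<forall>C\<in>\<C>. \<exists>n. cyclic_n3_configuration n C \<and> unsplittable C)"
proof (intro exI conjI)
  let ?\<C> = "cyclic_structure ` {7..}"
  \<comment> \<open>The number of points recovers \<open>n\<close>, which makes
    \<open>cyclic_structure\<close> injective; being an isomorphism invariant, it also separates the
    isomorphism classes.\<close>
  have card: "card (points (cyclic_structure n)) = n" for n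
    by simp
  have "inj cyclic_structure"
    by (metis card injI)
  then show "infinite ?\<C>"
    by (meson finite_imageD infinite_Ici inj_on_subset subset_UNIV)
  show "pairwise (\<lambda>C D. \<not> isomorphic C D) ?\<C>"
    by (auto simp: pairwise_def dest: isomorphic_card_points)
  show "\<forall>C\<in>?\<C>. \<exists>n. cyclic_n3_configuration n C \<and> unsplittable C"
    using cyclic_n3_cyclic_structure unsplittable_cyclic_structure by auto
qed

end
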